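(* Let $\{X_i, i\ge 1\}$ be independent and identically distributed random variables with $P\{X_1=0\}=P\{X_1=1\}=\frac12$, and let $M_N$ be the number of switches of the longest run of consecutive switches in $(X_1,\dots,X_N)$. Then $$\lim_{N\to\infty}\frac{M_N}{\log N}=1\quad\text{a.s.}$$
   Context: All random variables are defined on a probability space $(\Omega,\mathcal F,P)$. The symbol $\log$ denotes the logarithm with base $2$. For integers $m,n\ge 1$ let $$S_n^{(m)}=\sum_{i=m+1}^{n+m-1}(1-X_{i-1})X_i+\sum_{i=m+1}^{n+m-1}X_{i-1}(1-X_i),$$ which is the total number of switches (indices $i$ with $X_{i-1}\neq X_i$) in the block $(X_m,\dots,X_{m+n-1})$ (an empty sum is $0$, so $S_1^{(m)}=0$). For integers $i,N\ge 1$ and $1\le n\le N$ let $H_{n,i}^{(N)}=\bigcup_{i\le m\le i+N-n}\{S_n^{(m)}=n-1\}$, the event that some block of $n$ consecutive terms of $(X_i,\dots,X_{i+N-1})$ consists entirely of switches. Define the random variable $M_N^{(i)}(\omega)=\max\{n-1: 1\le n\le N,\ \omega\in H_{n,i}^{(N)}\}$ and $M_N=M_N^{(1)}$. *)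

theory Defs
  imports "HOL-Probability.Probability"
begin

text \<open>The sequence \<open>X\<close> is indexed from 1; the value \<open>X 0\<close> is never used. The \<open>X i\<close> are real-valued,
  so that \<open>X i \<omega> \<in> {0, 1}\<close> is only guaranteed almost surely, as in the usual reading of
  \<open>P{X = 0} = P{X = 1} = 1/2\<close>.\<close>

definition num_switches :: "(nat \<Rightarrow> 'a \<Rightarrow> real) \<Rightarrow> nat \<Rightarrow> nat \<Rightarrow> 'a \<Rightarrow> real" where
  "num_switches X m n \<omega> =
     (\<Sum>i = m+1..n+m-1. (1 - X (i-1) \<omega>) * X i \<omega>) +
     (\<Sum>i = m+1..n+m-1. X (i-1) \<omega> * (1 - X i \<omega>))"

definition switch_run_event ::
    "'a measure \<Rightarrow> (nat \<Rightarrow> 'a \<Rightarrow> real) \<Rightarrow> nat \<Rightarrow> nat \<Rightarrow> nat \<Rightarrow> 'a set" where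
  "switch_run_event P X N i n =
     (\<Union>m\<in>{i..i+N-n}. {\<omega> \<in> space P. num_switches X m n \<omega> = real n - 1})"

text \<open>For \<open>N \<ge> 1\<close> and \<open>\<omega> \<in> space P\<close> the set below is finite and contains 0 (take \<open>n = 1\<close>), so \<open>Max\<close>
  is a genuine maximum.\<close>

definition longest_switch_run_from ::
    "'a measure \<Rightarrow> (nat \<Rightarrow> 'a \<Rightarrow> real) \<Rightarrow> nat \<Rightarrow> nat \<Rightarrow> 'a \<Rightarrow> nat" where
  "longest_switch_run_from P X i N \<omega> =
     Max {n - 1 | n. 1 \<le> n \<and> n \<le> N \<and> \<omega> \<in> switch_run_event P X N i n}"

definition longest_switch_run ::
    "'a measure \<Rightarrow> (nat \<Rightarrow> 'a \<Rightarrow> real) \<Rightarrow> nat \<Rightarrow> 'a \<Rightarrow> nat" where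
  "longest_switch_run P X N = longest_switch_run_from P X 1 N"

end

theory Submission
  imports Defs "HOL-Real_Asymp.Real_Asymp"
begin

text \<open>A block of \<open>k + 1\<close> flips consists of switches only iff it alternates, and each of the two
  alternating patterns has probability \<open>2 ^ - (k + 1)\<close>. Upper bound: the probabilities that a run of
  at least \<open>(1 + e) log m\<close> switches starts at \<open>m\<close> are summable over \<open>m\<close>, and a long run starting
  before an exceptional finite time would contain a long one starting at that time. Lower bound:
  \<open>(X\<^sub>1, \<dots>, X\<^sub>N)\<close> contains about \<open>N / ((1 - e) log N + 1)\<close> disjoint, hence independent, blocks with
  \<open>(1 - e) log N\<close> possible switches each, and the probability that none of them alternates is at most
  \<open>exp (- N powr e / log N)\<close> up to constants in the exponent, which is summable. Both use the first
  Borel--Cantelli lemma.\<close>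

section \<open>Deterministic part: blocks consisting of switches as alternating patterns\<close>

text \<open>\<open>c\<close> is the value of the flip at \<open>m\<close>, and \<open>k\<close>
  counts switches, so \<open>k + 1\<close> flips are prescribed. Fixing the starting value makes
  each pattern a single cylinder event.\<close>

definition alternating :: "(nat \<Rightarrow> 'a \<Rightarrow> real) \<Rightarrow> bool \<Rightarrow> nat \<Rightarrow> nat \<Rightarrow> 'a \<Rightarrow> bool" where
  "alternating X c m k \<omega> \<longleftrightarrow> (\<forall>r\<le>k. X (m + r) \<omega> = of_bool (c \<noteq> odd r))"

lemma num_switches_Suc:
  assumes "n \<ge> 1"
  shows "num_switches X m (Suc n) \<omega> = num_switches X m n \<omega> +
    (1 - X (m + n - 1) \<omega>) * X (m + n) \<omega> + X (m + n - 1) \<omega> * (1 - X (m + n) \<omega>)"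
proof -
  have "{m + 1..Suc n + m - 1} = insert (m + n) {m + 1..n + m - 1}"
    using assms by auto
  then show ?thesis
    using assms by (simp add: num_switches_def)
qed

text \<open>For values in {0, 1} each new index contributes
  \<open>(1 - a) * b + a * (1 - b)\<close>, which is 0 or 1.\<close>

lemma num_switches_le:
  assumes "m \<ge> 1" and "\<And>i. i \<ge> 1 \<Longrightarrow> X i \<omega> \<in> {0, 1}"
  shows "num_switches X m (Suc k) \<omega> \<le> real k"
proof (induction k)
  case 0
  then show ?case by (simp add: num_switches_def)
next
  case (Suc k)
  then show ?case
    using assms(2)[of "m + k"] assms(2)[of "m + Suc k"] assms(1)
    by (auto simp: num_switches_Suc[of "Suc k"])
qed

text \<open>Since every index contributes at most 1, the maximal count \<open>Suc k\<close> is
  reached only if the first \<open>k\<close> steps already count \<open>k\<close> and the last flip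
  is the complement of its predecessor. The induction then extends the pattern by one flip.\<close>

lemma num_switches_eq_iff_alternating:
  assumes "m \<ge> 1" and "\<And>i. i \<ge> 1 \<Longrightarrow> X i \<omega> \<in> {0, 1}"
  shows "num_switches X m (Suc k) \<omega> = real k \<longleftrightarrow> (\<exists>c. alternating X c m k \<omega>)"
proof (induction k)
  case 0
  then show ?case
    using assms(2)[of m] assms(1) by (auto simp: num_switches_def alternating_def)
next
  case (Suc k)
  have le: "num_switches X m (Suc k) \<omega> \<le> real k"
    using assms by (rule num_switches_le)
  have "num_switches X m (Suc (Suc k)) \<omega> = real (Suc k) \<longleftrightarrow>
      num_switches X m (Suc k) \<omega> = real k \<and> X (m + Suc k) \<omega> = 1 - X (m + k) \<omega>"
    using assms(2)[of "m + k"] assms(2)[of "m + Suc k"] assms(1) le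
    by (auto simp: num_switches_Suc[of "Suc k"])
  also have "\<dots> \<longleftrightarrow> (\<exists>c. alternating X c m (Suc k) \<omega>)"
  proof -
    have "alternating X c m (Suc k) \<omega> \<longleftrightarrow> alternating X c m k \<omega> \<and> X (m + Suc k) \<omega> = 1 - X (m + k) \<omega>" for c
    proof -
      have "alternating X c m (Suc k) \<omega> \<longleftrightarrow>
          alternating X c m k \<omega> \<and> X (m + Suc k) \<omega> = of_bool (c \<noteq> odd (Suc k))"
        unfolding alternating_def using le_Suc_eq by blast
      moreover have "X (m + k) \<omega> = of_bool (c \<noteq> odd k)" if "alternating X c m k \<omega>"
        using that unfolding alternating_def by blast
      ultimately show ?thesis by auto
    qed
    then show ?thesis unfolding Suc.IH by blast
  qed
  finally show ?case .
qed

text \<open>Dropping the first \<open>d\<close> flips leaves an alternating block whose starting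
  value is inverted exactly when \<open>d\<close> is odd. This moves the start of a run to a later
  position in the upper bound.\<close>

lemma alternating_suffix:
  assumes "alternating X c m k \<omega>" and "d \<le> k"
  shows "\<exists>c. alternating X c (m + d) (k - d) \<omega>"
proof
  show "alternating X (c \<noteq> odd d) (m + d) (k - d) \<omega>"
    unfolding alternating_def
  proof (intro allI impI)
    fix r assume "r \<le> k - d"
    then have "X (m + (d + r)) \<omega> = of_bool (c \<noteq> odd (d + r))"
      using assms unfolding alternating_def by auto
    moreover have "(c \<noteq> odd (d + r)) = ((c \<noteq> odd d) \<noteq> odd r)"
      by auto
    ultimately show "X (m + d + r) \<omega> = of_bool ((c \<noteq> odd d) \<noteq> odd r)"
      by (simp only: add.assoc)
  qed
qed

lemma alternating_mono:
  "alternating X c m k \<omega> \<Longrightarrow> k' \<le> k \<Longrightarrow> alternating X c m k' \<omega>"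
  by (auto simp: alternating_def)

lemma switch_run_event_iff:
  assumes "\<omega> \<in> space P" and "\<And>i. i \<ge> 1 \<Longrightarrow> X i \<omega> \<in> {0, 1}" and "Suc k \<le> N"
  shows "\<omega> \<in> switch_run_event P X N 1 (Suc k) \<longleftrightarrow>
    (\<exists>m c. 1 \<le> m \<and> m + k \<le> N \<and> alternating X c m k \<omega>)"
proof -
  have "\<omega> \<in> switch_run_event P X N 1 (Suc k) \<longleftrightarrow>
      (\<exists>m. 1 \<le> m \<and> m + k \<le> N \<and> num_switches X m (Suc k) \<omega> = real k)"
    using assms(1,3) by (auto simp: switch_run_event_def Bex_def)
  then show ?thesis
    using num_switches_eq_iff_alternating[where X = X and \<omega> = \<omega>, OF _ assms(2)] by blast
qed

text \<open>This and the next lemma replace \<open>Max\<close> by its two uses: any alternating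
  block bounds the maximum from below, and some alternating block attains it.\<close>

lemma le_longest_switch_run:
  assumes "\<omega> \<in> space P" and "\<And>i. i \<ge> 1 \<Longrightarrow> X i \<omega> \<in> {0, 1}"
    and "1 \<le> m" "m + k \<le> N" "alternating X c m k \<omega>"
  shows "k \<le> longest_switch_run P X N \<omega>"
proof -
  have "\<omega> \<in> switch_run_event P X N 1 (Suc k)"
    using assms by (subst switch_run_event_iff) auto
  moreover have "Suc k \<le> N"
    using assms by simp
  ultimately show ?thesis
    unfolding longest_switch_run_def longest_switch_run_from_def
    by (intro Max_ge) (auto intro!: exI[of _ "Suc k"])
qed

lemma longest_switch_run_attained:
  assumes "\<omega> \<in> space P" and "\<And>i. i \<ge> 1 \<Longrightarrow> X i \<omega> \<in> {0, 1}" and "1 \<le> N"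
  obtains m c where "1 \<le> m" "m + longest_switch_run P X N \<omega> \<le> N"
    "alternating X c m (longest_switch_run P X N \<omega>) \<omega>"
proof -
  define L where "L = longest_switch_run P X N \<omega>"
  \<comment> \<open>A block of one flip has zero switches, so the set under \<open>Max\<close> is
    nonempty.\<close>
  have one: "\<omega> \<in> switch_run_event P X N 1 (Suc 0)"
    using assms(1,3) by (auto simp: switch_run_event_def num_switches_def)
  have "L \<in> {n - 1 | n. 1 \<le> n \<and> n \<le> N \<and> \<omega> \<in> switch_run_event P X N 1 n}"
    unfolding L_def longest_switch_run_def longest_switch_run_from_def
    using one assms(3) by (intro Max_in) auto
  then obtain n where n: "L = n - 1" "1 \<le> n" "n \<le> N" "\<omega> \<in> switch_run_event P X N 1 n"
    by auto
  then have "n = Suc L" by simp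
  with n have "\<exists>m c. 1 \<le> m \<and> m + L \<le> N \<and> alternating X c m L \<omega>"
    using switch_run_event_iff[of \<omega> P X L N] assms by auto
  then show thesis
    using that unfolding L_def by blast
qed

section \<open>Probabilities of alternating blocks of independent fair flips\<close>

text \<open>Both values of a flip are treated at once through \<open>of_bool c\<close>, the form in
  which \<open>alternating\<close> prescribes them.\<close>

locale fair_coin_flips = prob_space M for M :: "'a measure" +
  fixes X :: "nat \<Rightarrow> 'a \<Rightarrow> real"
  assumes indep: "indep_vars (\<lambda>_. borel) X {1..}"
    and prob_flip: "\<And>i c. i \<ge> 1 \<Longrightarrow> prob {\<omega> \<in> space M. X i \<omega> = of_bool c} = 1 / 2"
begin

lemma measurable_flip: "i \<ge> 1 \<Longrightarrow> X i \<in> borel_measurable M"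
  using indep by (auto simp: indep_vars_def)

lemma sets_alternating:
  assumes "m \<ge> 1"
  shows "{\<omega> \<in> space M. alternating X c m k \<omega>} \<in> events"
proof -
  have [measurable]: "X (m + r) \<in> borel_measurable M" for r
    using assms by (intro measurable_flip) simp
  show ?thesis unfolding alternating_def by measurable
qed

lemma prob_alternating:
  assumes "m \<ge> 1"
  shows "prob {\<omega> \<in> space M. alternating X c m k \<omega>} = (1 / 2) ^ Suc k"
proof -
  \<comment> \<open>The pattern is reindexed by the absolute position \<open>i = m + r\<close>, so
    that independence turns the intersection into a product of \<open>k + 1\<close> factors
    1/2.\<close>
  let ?A = "\<lambda>i. {of_bool (c \<noteq> odd (i - m))} :: real set"
  have "{\<omega> \<in> space M. alternating X c m k \<omega>} = (\<Inter>i\<in>{m..m+k}. X i -` ?A i \<inter> space M)"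
  proof (intro equalityI subsetI)
    fix \<omega> assume \<omega>: "\<omega> \<in> {\<omega> \<in> space M. alternating X c m k \<omega>}"
    have "X i \<omega> = of_bool (c \<noteq> odd (i - m))" if "i \<in> {m..m+k}" for i
    proof -
      have "i - m \<le> k" "m + (i - m) = i"
        using that by auto
      then show ?thesis
        using \<omega> unfolding alternating_def by (metis (mono_tags, lifting) mem_Collect_eq)
    qed
    with \<omega> show "\<omega> \<in> (\<Inter>i\<in>{m..m+k}. X i -` ?A i \<inter> space M)"
      by blast
  next
    fix \<omega> assume \<omega>: "\<omega> \<in> (\<Inter>i\<in>{m..m+k}. X i -` ?A i \<inter> space M)"
    have "X (m + r) \<omega> = of_bool (c \<noteq> odd r)" if "r \<le> k" for r
    proof -
      have "m + r \<in> {m..m+k}"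
        using that by simp
      with \<omega> have "X (m + r) \<omega> \<in> ?A (m + r)"
        by blast
      then show ?thesis by simp
    qed
    moreover have "\<omega> \<in> space M"
      using \<omega> by (auto dest: bspec[of _ _ m])
    ultimately show "\<omega> \<in> {\<omega> \<in> space M. alternating X c m k \<omega>}"
      unfolding alternating_def by blast
  qed
  also have "prob \<dots> = (\<Prod>i\<in>{m..m+k}. prob (X i -` ?A i \<inter> space M))"
    using assms by (intro indep_varsD[OF indep]) auto
  also have "\<dots> = (\<Prod>i\<in>{m..m+k}. 1 / 2)"
  proof (intro prod.cong refl)
    fix i assume "i \<in> {m..m+k}"
    then have "prob {\<omega> \<in> space M. X i \<omega> = of_bool (c \<noteq> odd (i - m))} = 1 / 2"
      using assms by (intro prob_flip) auto
    then show "prob (X i -` ?A i \<inter> space M) = 1 / 2"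
      by (simp add: vimage_def Int_def conj_commute)
  qed
  finally show ?thesis by simp
qed

lemma AE_flip: "AE \<omega> in M. \<forall>i\<ge>1. X i \<omega> \<in> {0, 1}"
proof -
  have "AE \<omega> in M. i \<ge> 1 \<longrightarrow> X i \<omega> \<in> {0, 1}" for i
  proof (cases "i \<ge> 1")
    case True
    note [measurable] = measurable_flip[OF True]
    have "prob {\<omega> \<in> space M. X i \<omega> \<in> {0, 1}} =
        prob ({\<omega> \<in> space M. X i \<omega> = of_bool False} \<union> {\<omega> \<in> space M. X i \<omega> = of_bool True})"
      by (intro arg_cong[where f = prob]) auto
    also have "\<dots> = 1"
      using prob_flip[OF True, of False] prob_flip[OF True, of True]
      by (subst finite_measure_Union) auto
    finally have "AE \<omega> in M. \<omega> \<in> {\<omega> \<in> space M. X i \<omega> \<in> {0, 1}}"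
      by (rule AE_prob_1)
    then show ?thesis by eventually_elim auto
  qed auto
  then show ?thesis unfolding AE_all_countable by blast
qed

text \<open>The union over the two starting values costs a factor 2, which turns
  \<open>(1 / 2) ^ Suc (k m)\<close> into the summable \<open>(1 / 2) ^ k m\<close>; Borel-Cantelli
  applies.\<close>

lemma AE_eventually_no_alternating:
  assumes "summable (\<lambda>m. (1 / 2 :: real) ^ k m)"
  shows "AE \<omega> in M. eventually (\<lambda>m. \<forall>c. \<not> alternating X c m (k m) \<omega>) sequentially"
proof -
  \<comment> \<open>The shift to \<open>Suc m\<close> keeps starting positions at least 1; it is
    undone at the end.\<close>
  define A where "A = (\<lambda>m. {\<omega> \<in> space M. alternating X False (Suc m) (k (Suc m)) \<omega>} \<union>
    {\<omega> \<in> space M. alternating X True (Suc m) (k (Suc m)) \<omega>})"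
  have [measurable]: "A m \<in> events" for m
    unfolding A_def by (intro sets.Un sets_alternating) auto
  have "prob (A m) \<le> (1 / 2) ^ k (Suc m)" for m
  proof -
    have "prob (A m) \<le> (1 / 2) ^ Suc (k (Suc m)) + (1 / 2) ^ Suc (k (Suc m))"
      unfolding A_def
      using measure_Un_le[OF sets_alternating sets_alternating,
        of "Suc m" "Suc m" False "k (Suc m)" True "k (Suc m)"]
      by (simp add: prob_alternating)
    then show ?thesis by simp
  qed
  moreover have "summable (\<lambda>m. (1 / 2 :: real) ^ k (Suc m))"
    using assms summable_Suc_iff[of "\<lambda>m. (1 / 2 :: real) ^ k m"] by blast
  ultimately have "summable (\<lambda>m. prob (A m))"
    by (intro summable_comparison_test_ev[of "\<lambda>m. prob (A m)" "\<lambda>m. (1 / 2) ^ k (Suc m)"]) simp_all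
  then have "AE \<omega> in M. eventually (\<lambda>m. \<omega> \<in> space M - A m) sequentially"
    by (intro borel_cantelli_AE1) (auto simp: emeasure_eq_measure)
  then show ?thesis
  proof eventually_elim
    case (elim \<omega>)
    then have "eventually (\<lambda>m. \<forall>c. \<not> alternating X c (Suc m) (k (Suc m)) \<omega>) sequentially"
      by eventually_elim (auto simp: A_def all_bool_eq)
    then show ?case
      using eventually_sequentially_Suc[of "\<lambda>m. \<forall>c. \<not> alternating X c m (k m) \<omega>"] by simp
  qed
qed

text \<open>The \<open>q\<close> blocks occupy disjoint windows of \<open>k + 1\<close> flips, so
  the failures to alternate are independent. One starting value \<open>c\<close> is enough for a
  lower bound on the longest run.\<close>

lemma prob_no_alternating_block:
  "prob {\<omega> \<in> space M. \<forall>j<q. \<not> alternating X c (1 + j * Suc k) k \<omega>} = (1 - (1 / 2) ^ Suc k) ^ q"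
proof (cases "q = 0")
  case False
  define K where "K = (\<lambda>j. {1 + j * Suc k..<1 + Suc j * Suc k})"
  define Q where "Q = (\<lambda>j. PiM (K j) (\<lambda>_. borel :: real measure))"
  \<comment> \<open>The set of value vectors on window \<open>j\<close> that miss the pattern, so
    that each failure is an event of the restricted family alone.\<close>
  define Z where "Z = (\<lambda>j. space (Q j) -
    (\<Inter>r\<in>{..k}. {z \<in> space (Q j). z (1 + j * Suc k + r) = of_bool (c \<noteq> odd r)}))"
  have mem: "1 + j * Suc k + r \<in> K j" if "r \<le> k" for j r
    using that by (auto simp: K_def)
  have "disjoint_family_on K {..<q}"
  proof -
    \<comment> \<open>Integer division recovers the window from a position, hence the windows are
      disjoint.\<close>
    have "j = (i - 1) div Suc k" if "i \<in> K j" for i j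
    proof -
      have "i - 1 = j * Suc k + (i - 1 - j * Suc k)" "i - 1 - j * Suc k < Suc k"
        using that by (auto simp: K_def)
      then show ?thesis by (metis add.commute div_mult_self3 div_less add_0_right nat.distinct(1))
    qed
    then show ?thesis unfolding disjoint_family_on_def by blast
  qed
  then have ind: "indep_vars (\<lambda>j. PiM (K j) (\<lambda>_. borel)) (\<lambda>j \<omega>. restrict (\<lambda>i. X i \<omega>) (K j)) {..<q}"
    by (intro indep_vars_restrict[OF indep]) (auto simp: K_def)
  have Z: "Z j \<in> sets (PiM (K j) (\<lambda>_. borel))" for j
  proof -
    have "{z \<in> space (Q j). z (1 + j * Suc k + r) = of_bool (c \<noteq> odd r)} \<in> sets (Q j)"
      if "r \<le> k" for r
    proof -
      have [measurable]: "(\<lambda>z. z (1 + j * Suc k + r)) \<in> borel_measurable (Q j)"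
        unfolding Q_def using mem[OF that] by (rule measurable_component_singleton)
      show ?thesis by measurable
    qed
    then have "Z j \<in> sets (Q j)"
      unfolding Z_def by (intro sets.Diff sets.top sets.finite_INT) auto
    then show ?thesis unfolding Q_def .
  qed
  have vim: "(\<lambda>\<omega>. restrict (\<lambda>i. X i \<omega>) (K j)) -` Z j \<inter> space M =
      space M - {\<omega> \<in> space M. alternating X c (1 + j * Suc k) k \<omega>}" for j
    unfolding Z_def Q_def alternating_def space_PiM using mem[of _ j] by force
  have "{\<omega> \<in> space M. \<forall>j<q. \<not> alternating X c (1 + j * Suc k) k \<omega>} =
      (\<Inter>j\<in>{..<q}. (\<lambda>\<omega>. restrict (\<lambda>i. X i \<omega>) (K j)) -` Z j \<inter> space M)"
    unfolding vim using False by auto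
  also have "prob \<dots> = (\<Prod>j<q. prob ((\<lambda>\<omega>. restrict (\<lambda>i. X i \<omega>) (K j)) -` Z j \<inter> space M))"
    using False Z by (intro indep_varsD[OF ind]) auto
  also have "\<dots> = (\<Prod>j<q. 1 - (1 / 2) ^ Suc k)"
    unfolding vim by (subst prob_compl) (auto simp: prob_alternating sets_alternating simp del: power_Suc)
  finally show ?thesis by simp
qed (simp add: prob_space)

section \<open>Almost sure upper bound\<close>

lemma AE_eventually_longest_le:
  assumes "e > 0"
  shows "AE \<omega> in M. eventually (\<lambda>N. real (longest_switch_run M X N \<omega>) \<le> (1 + e) * log 2 (real N) + 1) sequentially"
proof -
  \<comment> \<open>The threshold depends on the starting position \<open>m\<close>, not on
    \<open>N\<close>, so the exceptional probabilities are compared with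
    \<open>m powr - (1 + e)\<close>. The ceiling accounts for the \<open>+ 1\<close> in the
    statement.\<close>
  define k where "k = (\<lambda>m. nat \<lceil>(1 + e) * log 2 (real m)\<rceil>)"
  have k_bound: "(1 / 2) ^ k m \<le> real m powr - (1 + e)" if "m \<ge> 1" for m
  proof -
    have "(1 / 2 :: real) ^ k m = 2 powr - real (k m)"
      by (simp add: powr_minus powr_realpow power_one_over divide_simps)
    also have "\<dots> \<le> 2 powr (- (1 + e) * log 2 (real m))"
      unfolding k_def by (intro powr_mono) linarith+
    also have "\<dots> = real m powr - (1 + e)"
      using that by (simp add: powr_def log_def)
    finally show ?thesis .
  qed
  have "summable (\<lambda>m. (1 / 2 :: real) ^ k m)"
  proof (rule summable_comparison_test'[where N = 1])
    show "summable (\<lambda>m. real m powr - (1 + e))"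
      using assms by (subst summable_real_powr_iff) auto
  qed (use k_bound in auto)
  from AE_eventually_no_alternating[OF this] AE_flip AE_space show ?thesis
  proof eventually_elim
    case (elim \<omega>)
    from elim(1) obtain m0 where m0: "m0 \<ge> 1" "\<And>m c. m \<ge> m0 \<Longrightarrow> \<not> alternating X c m (k m) \<omega>"
      unfolding eventually_sequentially by (meson le_trans max.cobounded1 max.cobounded2)
    have k_mono: "k m \<le> k m'" if "1 \<le> m" "m \<le> m'" for m m'
      using that assms unfolding k_def
      by (intro nat_mono ceiling_mono mult_left_mono) auto
    have bound: "longest_switch_run M X N \<omega> \<le> max (m0 + k m0) (k N)" if N: "N \<ge> 1" for N
    proof -
      define L where "L = longest_switch_run M X N \<omega>"
      obtain m c where mc: "1 \<le> m" "m + L \<le> N" "alternating X c m L \<omega>"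
        unfolding L_def
        by (rule longest_switch_run_attained[of \<omega> M X N]) (use elim(2,3) N in auto)
      show ?thesis
      proof (cases "m \<ge> m0")
        case True
        then have "L < k m"
          using m0(2)[OF True] alternating_mono[OF mc(3)] by (meson not_less)
        then show ?thesis
          using k_mono[of m N] mc unfolding L_def by simp
      next
        case False
        \<comment> \<open>Otherwise cutting off the first \<open>m0 - m\<close> flips would leave a
          run from \<open>m0\<close> with at least \<open>k m0\<close> switches. So early starts
          contribute only a bound independent of \<open>N\<close>, which
          \<open>log 2 (real N)\<close> eventually exceeds.\<close>
        have "L < m0 + k m0"
        proof (rule ccontr)
          assume *: "\<not> L < m0 + k m0"
          then have "m0 - m \<le> L" "m + (m0 - m) = m0"
            using False by auto
          then obtain c' where "alternating X c' m0 (L - (m0 - m)) \<omega>"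
            using alternating_suffix[OF mc(3), of "m0 - m"] by auto
          then show False
            using m0(2)[of m0 c'] alternating_mono[of X c' m0 "L - (m0 - m)" \<omega> "k m0"] * by simp
        qed
        then show ?thesis unfolding L_def by simp
      qed
    qed
    have "filterlim (\<lambda>N. (1 + e) * log 2 (real N)) at_top sequentially"
      using assms by real_asymp
    then have "eventually (\<lambda>N. real (m0 + k m0) \<le> (1 + e) * log 2 (real N)) sequentially"
      unfolding filterlim_at_top by blast
    then show ?case
      using eventually_ge_at_top[of 1]
    proof eventually_elim
      case (elim N)
      have "(1 + e) * log 2 (real N) \<ge> 0"
        using elim(2) assms by simp
      then have "real (k N) \<le> (1 + e) * log 2 (real N) + 1"
        unfolding k_def by linarith
      moreover have "real (longest_switch_run M X N \<omega>) \<le> real (max (m0 + k m0) (k N))"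
        using bound[OF elim(2)] by (simp only: of_nat_le_iff)
      ultimately show ?case
        using elim(1) by linarith
    qed
  qed
qed

section \<open>Almost sure lower bound\<close>

lemma AE_eventually_longest_ge:
  assumes "0 < e" "e < 1"
  shows "AE \<omega> in M. eventually (\<lambda>N. real (longest_switch_run M X N \<omega>) \<ge> (1 - e) * log 2 (real N) - 1) sequentially"
proof -
  define k where "k = (\<lambda>N. nat \<lfloor>(1 - e) * log 2 (real N)\<rfloor>)"
  define A where "A = (\<lambda>N. {\<omega> \<in> space M. \<forall>j<N div Suc (k N). \<not> alternating X False (1 + j * Suc (k N)) (k N) \<omega>})"
  \<comment> \<open>This is \<open>exp (- (p * q))\<close> with lower bounds inserted for the
    success probability \<open>p\<close> of one block and the number \<open>q\<close> of blocks. The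
    exponent grows like \<open>x powr e / log 2 x\<close>, up to constants.\<close>
  define g where "g = (\<lambda>x::real. exp (- (1 / (2 * x powr (1 - e)) * (x / (log 2 x + 1) - 1))))"
  have A: "A N \<in> events" for N
  proof -
    have [measurable]: "Measurable.pred M (alternating X False (1 + j * Suc (k N)) (k N))" for j
      using sets_alternating[of "1 + j * Suc (k N)"] by (simp add: pred_def)
    show ?thesis unfolding A_def by measurable
  qed
  have prob_A: "prob (A N) \<le> g (real N)" if "N \<ge> 2" for N
  proof -
    define p :: real where "p = (1 / 2) ^ Suc (k N)"
    define q where "q = N div Suc (k N)"
    have log_ge: "log 2 (real N) \<ge> 1"
      using that by simp
    then have k_le: "real (k N) \<le> (1 - e) * log 2 (real N)"
      using assms unfolding k_def by simp
    have "2 ^ Suc (k N) = 2 * 2 powr real (k N)"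
      by (simp add: powr_realpow)
    also have "\<dots> \<le> 2 * 2 powr ((1 - e) * log 2 (real N))"
      using k_le by simp
    also have "\<dots> = 2 * real N powr (1 - e)"
      using that by (simp add: powr_def log_def)
    finally have p: "p \<ge> 1 / (2 * real N powr (1 - e))"
      unfolding p_def power_one_over using that by (intro divide_left_mono) auto
    have "real (Suc (k N)) \<le> log 2 (real N) + 1"
      using k_le log_ge assms mult_right_mono[of "1 - e" 1 "log 2 (real N)"] by linarith
    then have "real N / (log 2 (real N) + 1) \<le> real N / real (Suc (k N))"
      using log_ge by (intro divide_left_mono) auto
    also have "\<dots> \<le> real q + 1"
    proof -
      have "N \<le> (q + 1) * Suc (k N)"
        unfolding q_def using dividend_less_times_div[of "Suc (k N)" N] by (simp add: algebra_simps)
      then have "real N \<le> real ((q + 1) * Suc (k N))"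
        by (rule of_nat_mono)
      also have "\<dots> = (real q + 1) * real (Suc (k N))"
        by (simp only: of_nat_mult of_nat_add of_nat_1)
      finally show ?thesis
        by (subst pos_divide_le_eq) auto
    qed
    finally have q: "real q \<ge> real N / (log 2 (real N) + 1) - 1"
      by simp
    \<comment> \<open>This makes the lower bound for \<open>q\<close> nonnegative, as needed to
      multiply it with the one for \<open>p\<close>.\<close>
    have "log 2 (real N) + 1 \<le> real N"
    proof -
      have "N \<le> 2 ^ (N - 1)"
        using that less_exp[of "N - 1"] by linarith
      then have "real N \<le> 2 powr real (N - 1)"
        by (simp add: powr_realpow)
      then have "log 2 (real N) \<le> real (N - 1)"
        using that by (subst log_le_iff) auto
      then show ?thesis using that by simp
    qed
    then have q0: "real N / (log 2 (real N) + 1) - 1 \<ge> 0"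
      using log_ge by (simp add: field_simps)
    have "prob (A N) = (1 - p) ^ q"
      unfolding A_def p_def q_def by (rule prob_no_alternating_block)
    also have "\<dots> \<le> exp (- p) ^ q"
      using exp_ge_add_one_self[of "- p"] by (intro power_mono) (auto simp: p_def power_le_one simp del: power_Suc)
    also have "\<dots> = exp (- (p * real q))"
      by (simp add: exp_of_nat_mult[symmetric] mult.commute)
    also have "\<dots> \<le> g (real N)"
      unfolding g_def using mult_mono[OF p q] q0 by (simp add: p_def)
    finally show ?thesis .
  qed
  \<comment> \<open>\<open>g\<close> decays faster than every power; the exponent -2 is one
    convenient summable choice.\<close>
  have "g \<in> O(\<lambda>x. x powr -2)"
    unfolding g_def using assms by real_asymp
  then have "(\<lambda>N. g (real N)) \<in> O(\<lambda>N. real N powr -2)"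
    by (rule landau_o.big.compose) (rule filterlim_real_sequentially)
  then have "summable (\<lambda>N. g (real N))"
    by (rule summable_comparison_test_bigo[rotated]) (simp add: summable_real_powr_iff)
  then have "summable (\<lambda>N. prob (A N))"
    by (rule summable_comparison_test') (use prob_A in auto)
  then have "AE \<omega> in M. eventually (\<lambda>N. \<omega> \<in> space M - A N) sequentially"
    using A by (intro borel_cantelli_AE1) (auto simp: emeasure_eq_measure)
  from this AE_flip AE_space show ?thesis
  proof eventually_elim
    case (elim \<omega>)
    from elim(1) show ?case
    proof eventually_elim
      case (elim N)
      then obtain j where j: "j < N div Suc (k N)" "alternating X False (1 + j * Suc (k N)) (k N) \<omega>"
        by (auto simp: A_def)
      \<comment> \<open>Block \<open>j\<close> ends exactly at position
        \<open>Suc j * Suc (k N)\<close>, so it lies within the first \<open>N\<close>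
        flips.\<close>
      have "Suc j * Suc (k N) \<le> N div Suc (k N) * Suc (k N)"
        using j(1) by (intro mult_right_mono) auto
      also have "\<dots> \<le> N" by (rule div_times_less_eq_dividend)
      finally have "1 + j * Suc (k N) + k N \<le> N" by simp
      then have "k N \<le> longest_switch_run M X N \<omega>"
        using j(2) \<open>\<forall>i\<ge>1. X i \<omega> \<in> {0, 1}\<close> \<open>\<omega> \<in> space M\<close>
        by (intro le_longest_switch_run[of \<omega> M X "1 + j * Suc (k N)"]) auto
      moreover have "(1 - e) * log 2 (real N) - 1 \<le> real (k N)"
        unfolding k_def by linarith
      ultimately show ?case by linarith
    qed
  qed
qed

section \<open>Combination of both bounds into the almost sure limit\<close>

lemma AE_longest_switch_run_tendsto:
  "AE \<omega> in M. (\<lambda>N. real (longest_switch_run M X N \<omega>) / log 2 (real N)) \<longlonglongrightarrow> 1"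
proof -
  \<comment> \<open>A countable sequence in (0, 1) tending to 0, so that the exceptional null sets
    for all \<open>e n\<close> together form a null set.\<close>
  define e where "e = (\<lambda>n. 1 / (real n + 2))"
  have e: "0 < e n" "e n < 1" for n
    by (auto simp: e_def)
  have "AE \<omega> in M. \<forall>n. eventually (\<lambda>N. real (longest_switch_run M X N \<omega>) \<le> (1 + e n) * log 2 (real N) + 1) sequentially"
    unfolding AE_all_countable using e by (blast intro: AE_eventually_longest_le)
  moreover have "AE \<omega> in M. \<forall>n. eventually (\<lambda>N. real (longest_switch_run M X N \<omega>) \<ge> (1 - e n) * log 2 (real N) - 1) sequentially"
    unfolding AE_all_countable using e by (blast intro: AE_eventually_longest_ge)
  ultimately show ?thesis
  proof eventually_elim
    case (elim \<omega>)
    show ?case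
    proof (rule tendstoI)
      fix \<epsilon> :: real assume \<epsilon>: "\<epsilon> > 0"
      have "e \<longlonglongrightarrow> 0" unfolding e_def by real_asymp
      then have "eventually (\<lambda>n. e n < \<epsilon> / 2) sequentially"
        using \<epsilon> by (intro order_tendstoD) auto
      then obtain n where n: "e n < \<epsilon> / 2"
        by (auto simp: eventually_sequentially)
      have "filterlim (\<lambda>N. log 2 (real N)) at_top sequentially"
        by real_asymp
      \<comment> \<open>Half of \<epsilon> absorbs the additive error 1, which is below
        \<open>\<epsilon> / 2 * l\<close> here; the other half absorbs
        \<open>e n * l\<close>.\<close>
      then have "eventually (\<lambda>N. log 2 (real N) > 2 / \<epsilon>) sequentially"
        unfolding filterlim_at_top_dense by blast
      with elim[THEN spec, of n]
      show "eventually (\<lambda>N. dist (real (longest_switch_run M X N \<omega>) / log 2 (real N)) 1 < \<epsilon>) sequentially"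
      proof eventually_elim
        case (elim N)
        define l where "l = log 2 (real N)"
        have l: "l > 0" "1 < \<epsilon> / 2 * l"
          using elim(3) \<epsilon> unfolding l_def[symmetric]
          by (auto simp: field_simps intro: less_trans[of 0 "2 / \<epsilon>"])
        have "e n * l < \<epsilon> / 2 * l"
          using n l(1) by (rule mult_strict_right_mono)
        then have "\<bar>real (longest_switch_run M X N \<omega>) - l\<bar> < \<epsilon> * l"
          using elim(1,2) l unfolding l_def[symmetric] distrib_right left_diff_distrib by linarith
        then show ?case
          using l(1) unfolding l_def[symmetric] dist_real_def
          by (simp add: field_simps abs_less_iff)
      qed
    qed
  qed
qed

end

theorem theorem3p1:
  fixes P :: "'a measure" and X :: "nat \<Rightarrow> 'a \<Rightarrow> real"
  assumes "prob_space P"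
    and indep: "prob_space.indep_vars P (\<lambda>_. borel) X {1..}"
    and ident: "\<And>i. i \<ge> 1 \<Longrightarrow> distr P borel (X i) = distr P borel (X 1)"
    and "measure P {\<omega> \<in> space P. X 1 \<omega> = 0} = 1/2"
    and "measure P {\<omega> \<in> space P. X 1 \<omega> = 1} = 1/2"
  shows "AE \<omega> in P. (\<lambda>N. real (longest_switch_run P X N \<omega>) / log 2 (real N)) \<longlonglongrightarrow> 1"
proof -
  interpret prob_space P by fact
  have meas: "X i \<in> borel_measurable P" if "i \<ge> 1" for i
    using indep that by (auto simp: indep_vars_def)
  \<comment> \<open>Point probabilities are masses of singletons under the law, so equality of laws
    carries the value 1/2 from \<open>X 1\<close> to every \<open>X i\<close>.\<close>
  have distr_eq: "measure (distr P borel (X i)) {x} = prob {\<omega> \<in> space P. X i \<omega> = x}" if "i \<ge> 1" for i x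
    using meas[OF that] by (simp add: measure_distr vimage_def Int_def conj_commute)
  have "fair_coin_flips P X"
  proof unfold_locales
    show "indep_vars (\<lambda>_. borel) X {1..}" by fact
    fix i :: nat and c assume "i \<ge> 1"
    then have "prob {\<omega> \<in> space P. X i \<omega> = of_bool c} = prob {\<omega> \<in> space P. X 1 \<omega> = of_bool c}"
      using distr_eq[of i] distr_eq[of 1] ident[of i] by simp
    also have "\<dots> = 1 / 2"
      using assms(4,5) by (cases c) auto
    finally show "prob {\<omega> \<in> space P. X i \<omega> = of_bool c} = 1 / 2" .
  qed
  then show ?thesis
    by (rule fair_coin_flips.AE_longest_switch_run_tendsto)
qed

end
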